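(* Let $N$ be a univariate Hawkes process on $(0,\infty)$ with baseline intensity $\lambda_0>0$ and monotone measurable kernel $h:[0,\infty)\to\mathbb{R}$ satisfying $\lim_{t\to\infty}h(t)=0$. Let $T_1<T_2<\cdots$ be its event times, $\lambda^\star$ its underlying intensity function, $(T_k^\star)_{k\ge 1}$ its restart times and $\Lambda$ its compensator. Then for any $t>0$, $$ \Lambda(t)= \begin{cases} \lambda_0 t & \text{if } t<T_1,\\[4pt] \displaystyle \lambda_0 T_1+\sum_{k=1}^{N(t)-1}\int_{T_k^\star}^{T_{k+1}}\lambda^\star(u)\,\mathrm{d}u+\int_{T_{N(t)}^\star}^{t}\lambda^\star(u)\,\mathrm{d}u & \text{if } t\ge T_1, \end{cases} $$ with the conventions that the sum is equal to $0$ if $N(t)=1$ and that the last integral is equal to $0$ if $t<T_{N(t)}^\star$.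
   Context: $N$ is a (simple) point process on $(0,\infty)$ with event times $0<T_1<T_2<\cdots$ (convention $T_0=0$), and $N(t)=\sum_{k\ge1}\mathbf{1}_{T_k\le t}$ is the number of events in $[0,t]$. For real $x$, $x^+=\max(0,x)$. $N$ is a univariate Hawkes process with baseline $\lambda_0>0$ and kernel $h$ if its conditional intensity is $$\lambda(t)=\Big(\lambda_0+\int_0^t h(t-s)\,\mathrm{d}N(s)\Big)^+=\Big(\lambda_0+\sum_{T_k\le t}h(t-T_k)\Big)^+ .$$ The kernel may be negative (inhibition) or positive (self-excitation). The compensator is $\Lambda(t)=\int_0^t\lambda(u)\,\mathrm{d}u$. The underlying intensity function is $\lambda^\star(t)=\lambda_0+\int_0^t h(t-s)\,\mathrm{d}N(s)=\lambda_0+\sum_{T_k\le t}h(t-T_k)$, so that $\lambda=(\lambda^\star)^+$. For $k\ge1$, the restart time is $T_k^\star=\inf\{t\ge T_k : \lambda(t)>0\}$. Identities between random quantities are understood almost surely; in particular, since $\lambda$ is the conditional intensity of $N$, almost surely every event time satisfies $\lambda(T_k^-)>0$, where $\lambda(T_k^-)=\lim_{s\uparrow T_k}\lambda(s)$. *)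

theory Defs
  imports "HOL-Probability.Probability"
begin

text \<open>A point process is given by its event times \<^term>\<open>T :: nat \<Rightarrow> 'a \<Rightarrow> real\<close>, where the
  process proper consists of the \<^term>\<open>T k\<close> with \<open>k \<ge> 1\<close>, and \<open>T 0 = 0\<close> is the usual convention.
  Divergence of the event times is local finiteness of the process.\<close>

definition simple_point_process :: "'a measure \<Rightarrow> (nat \<Rightarrow> 'a \<Rightarrow> real) \<Rightarrow> bool" where
  "simple_point_process M T \<longleftrightarrow>
     (\<forall>k. T k \<in> borel_measurable M) \<and>
     (\<forall>\<omega>\<in>space M. T 0 \<omega> = 0 \<and> strict_mono (\<lambda>k. T k \<omega>) \<and>
        filterlim (\<lambda>k. T k \<omega>) at_top sequentially)"

definition event_count :: "(nat \<Rightarrow> 'a \<Rightarrow> real) \<Rightarrow> real \<Rightarrow> 'a \<Rightarrow> nat" where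
  "event_count T t \<omega> = card {k. 1 \<le> k \<and> T k \<omega> \<le> t}"

text \<open>The internal history, i.e. the \<open>\<sigma>\<close>-algebra generated by the \<open>N(s)\<close> with \<open>0 \<le> s \<le> t\<close>.\<close>

definition history :: "'a measure \<Rightarrow> (nat \<Rightarrow> 'a \<Rightarrow> real) \<Rightarrow> real \<Rightarrow> 'a measure" where
  "history M T t =
     sigma (space M) {event_count T s -` {n} \<inter> space M | s n. 0 \<le> s \<and> s \<le> t}"

definition predictable :: "'a measure \<Rightarrow> (real \<Rightarrow> 'a measure) \<Rightarrow> (real \<times> 'a) measure" where
  "predictable M F =
     sigma ({0<..} \<times> space M) {{s<..t} \<times> A | s t A. 0 \<le> s \<and> s < t \<and> A \<in> sets (F s)}"

text \<open>Intensity with respect to the history \<^term>\<open>F\<close>: a nonnegative, progressively measurable,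
  almost surely locally integrable process \<open>\<lambda>\<close> with
  \<open>E[\<integral>\<^sub>(\<^sub>0\<^sub>,\<^sub>\<infinity>\<^sub>) C dN] = E[\<integral>\<^sub>(\<^sub>0\<^sub>,\<^sub>\<infinity>\<^sub>) C(u) \<lambda>(u) du]\<close> for every nonnegative predictable \<open>C\<close>.
  The process \<open>\<lambda>\<close> itself need not be predictable; the identity only sees it up to
  \<open>du\<close>-null sets.\<close>

definition conditional_intensity ::
  "'a measure \<Rightarrow> (real \<Rightarrow> 'a measure) \<Rightarrow> (nat \<Rightarrow> 'a \<Rightarrow> real) \<Rightarrow> (real \<Rightarrow> 'a \<Rightarrow> real) \<Rightarrow> bool" where
  "conditional_intensity M F T lam \<longleftrightarrow>
     (\<forall>t\<ge>0. \<forall>\<omega>\<in>space M. 0 \<le> lam t \<omega>) \<and>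
     (\<forall>t\<ge>0. (\<lambda>(s, \<omega>). lam s \<omega>) \<in> borel_measurable (restrict_space borel {0..t} \<Otimes>\<^sub>M F t)) \<and>
     (AE \<omega> in M. \<forall>t\<ge>0. set_integrable lborel {0..t} (\<lambda>u. lam u \<omega>)) \<and>
     (\<forall>C :: real \<times> 'a \<Rightarrow> ennreal. C \<in> borel_measurable (predictable M F) \<longrightarrow>
        (\<integral>\<^sup>+\<omega>. (\<Sum>k. C (T (Suc k) \<omega>, \<omega>)) \<partial>M) =
        (\<integral>\<^sup>+\<omega>. (\<integral>\<^sup>+u\<in>{0<..}. C (u, \<omega>) * ennreal (lam u \<omega>) \<partial>lborel) \<partial>M))"

text \<open>A kernel on \<open>[0, \<infinity>)\<close> is a function on the reals that is only ever evaluated at nonnegative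
  arguments.\<close>

definition underlying_intensity ::
  "real \<Rightarrow> (real \<Rightarrow> real) \<Rightarrow> (nat \<Rightarrow> 'a \<Rightarrow> real) \<Rightarrow> real \<Rightarrow> 'a \<Rightarrow> real" where
  "underlying_intensity lam0 h T t \<omega> =
     lam0 + (\<Sum>k | 1 \<le> k \<and> T k \<omega> \<le> t. h (t - T k \<omega>))"

definition hawkes_intensity ::
  "real \<Rightarrow> (real \<Rightarrow> real) \<Rightarrow> (nat \<Rightarrow> 'a \<Rightarrow> real) \<Rightarrow> real \<Rightarrow> 'a \<Rightarrow> real" where
  "hawkes_intensity lam0 h T t \<omega> = max 0 (underlying_intensity lam0 h T t \<omega>)"

definition hawkes_process ::
  "'a measure \<Rightarrow> real \<Rightarrow> (real \<Rightarrow> real) \<Rightarrow> (nat \<Rightarrow> 'a \<Rightarrow> real) \<Rightarrow> bool" where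
  "hawkes_process M lam0 h T \<longleftrightarrow>
     prob_space M \<and> simple_point_process M T \<and>
     conditional_intensity M (history M T) T (hawkes_intensity lam0 h T)"

definition compensator ::
  "real \<Rightarrow> (real \<Rightarrow> real) \<Rightarrow> (nat \<Rightarrow> 'a \<Rightarrow> real) \<Rightarrow> real \<Rightarrow> 'a \<Rightarrow> real" where
  "compensator lam0 h T t \<omega> = (LBINT u=0..t. hawkes_intensity lam0 h T u \<omega>)"

text \<open>For a Hawkes process, the set below is almost surely nonempty, since the intensity is
  positive just before the event \<open>T (k + 1)\<close>; so the infimum of reals is the intended one.\<close>

definition restart_time ::
  "real \<Rightarrow> (real \<Rightarrow> real) \<Rightarrow> (nat \<Rightarrow> 'a \<Rightarrow> real) \<Rightarrow> nat \<Rightarrow> 'a \<Rightarrow> real" where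
  "restart_time lam0 h T k \<omega> = Inf {t. T k \<omega> \<le> t \<and> 0 < hawkes_intensity lam0 h T t \<omega>}"

end

theory Submission
  imports Defs
begin

text \<open>
  Fix a path, write \<open>\<lambda>\<^sup>*\<close> for the underlying intensity and \<open>\<lambda>\<close> for its positive part. Between two
  consecutive events \<open>\<lambda>\<^sup>*\<close> is a fixed finite sum of translates of the kernel. The whole argument
  rests on one consequence of monotonicity of the kernel: once \<open>\<lambda>\<close> is positive, it stays positive
  until the next event (\<open>underlying_intensity_pos_persists\<close>). A nondecreasing kernel makes \<open>\<lambda>\<^sup>*\<close>
  nondecreasing between events; a nonincreasing kernel that tends to \<open>0\<close> is nonnegative, so
  \<open>\<lambda>\<^sup>*\<close> never drops below the baseline. Hence, on the interval from \<open>T k\<close> to \<open>T (k + 1)\<close>, \<open>\<lambda>\<close> vanishes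
  before the restart time and equals \<open>\<lambda>\<^sup>*\<close> after it, and integrating over the successive intervals
  gives the formula.

  This requires each restart time to come before the next event; otherwise the integral from the restart
  time to \<open>T (k + 1)\<close> would run backwards. That holds almost surely, because an event cannot occur
  after a stretch of zero intensity (\<open>AE_intensity_pos_before_event\<close>). To derive this from the integral
  characterisation of the intensity, take for \<open>C\<close> the indicator of the set \<open>D\<close> of all \<open>(u, \<omega>)\<close>
  for which \<open>\<lambda>\<close> vanishes from the last event strictly before \<open>u\<close> (time \<open>0\<close> if there is none) up to,
  but excluding, \<open>u\<close>. Along a path,
  \<open>\<lambda>\<close> can be positive at a time of \<open>D\<close> only if that time is an event or a restart time, so only on a
  countable set. The expected number of events falling in \<open>D\<close> is therefore \<open>0\<close>. Predictability of \<open>D\<close>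
  is obtained by evaluating \<open>\<lambda>\<close> on finer and finer grids to the left of \<open>u\<close>
  (\<open>predictable_left_grid\<close>); persistence of positivity ensures that these values detect whether \<open>\<lambda>\<close>
  was positive before \<open>u\<close>.
\<close>

section \<open>Event counts along a path\<close>

lemma event_index_eq:
  assumes "strict_mono (\<lambda>k. T k \<omega>)" "T n \<omega> \<le> s" "s < T (Suc n) \<omega>"
  shows "{k. 1 \<le> k \<and> T k \<omega> \<le> (s::real)} = {1..n}"
proof -
  have iff: "T k \<omega> \<le> s \<longleftrightarrow> k \<le> n" for k
  proof
    assume "T k \<omega> \<le> s"
    then have "T k \<omega> < T (Suc n) \<omega>" using assms(3) by linarith
    then show "k \<le> n" using strict_mono_less[OF assms(1), of k "Suc n"] by simp
  next
    assume "k \<le> n"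
    then have "T k \<omega> \<le> T n \<omega>" using strict_mono_less_eq[OF assms(1), of k n] by simp
    then show "T k \<omega> \<le> s" using assms(2) by linarith
  qed
  show ?thesis unfolding iff by auto
qed

lemma event_count_eq:
  assumes "strict_mono (\<lambda>k. T k \<omega>)" "T n \<omega> \<le> s" "s < T (Suc n) \<omega>"
  shows "event_count T s \<omega> = n"
  unfolding event_count_def event_index_eq[where T = T and \<omega> = \<omega>, OF assms] by simp

lemma underlying_intensity_eq:
  assumes "strict_mono (\<lambda>k. T k \<omega>)" "T n \<omega> \<le> s" "s < T (Suc n) \<omega>"
  shows "underlying_intensity lam0 h T s \<omega> = lam0 + (\<Sum>k = 1..n. h (s - T k \<omega>))"
  unfolding underlying_intensity_def event_index_eq[where T = T and \<omega> = \<omega>, OF assms] by simp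

lemma ex_event_interval:
  assumes "simple_point_process M T" "\<omega> \<in> space M" "0 \<le> s"
  obtains n where "T n \<omega> \<le> s" "s < T (Suc n) \<omega>"
proof -
  have T0: "T 0 \<omega> = 0" and lim: "filterlim (\<lambda>k. T k \<omega>) at_top sequentially"
    using assms by (auto simp: simple_point_process_def)
  have "\<exists>m. s < T m \<omega>"
    using lim by (metis eventually_sequentially filterlim_at_top_dense le_refl)
  then have lt: "s < T (LEAST m. s < T m \<omega>) \<omega>" (is "s < T ?m \<omega>") by (rule LeastI_ex)
  then have "?m \<noteq> 0" using T0 assms(3) by (metis not_less)
  then obtain n where n: "?m = Suc n" by (auto simp: gr0_conv_Suc)
  then have "T n \<omega> \<le> s" by (metis lessI not_less not_less_Least)
  then show ?thesis using that lt n by simp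
qed

lemma event_count_eq_iff:
  assumes "simple_point_process M T" "\<omega> \<in> space M" "0 \<le> s"
  shows "event_count T s \<omega> = n \<longleftrightarrow> T n \<omega> \<le> s \<and> s < T (Suc n) \<omega>"
proof -
  have sm: "strict_mono (\<lambda>k. T k \<omega>)" using assms by (auto simp: simple_point_process_def)
  obtain m where "T m \<omega> \<le> s" "s < T (Suc m) \<omega>" using ex_event_interval[OF assms] .
  then show ?thesis using event_count_eq[where T = T, OF sm] by metis
qed

section \<open>Measurability with respect to the internal history\<close>

lemma space_history: "space (history M T t) = space M"
  unfolding history_def by (rule space_measure_of) auto

text \<open>Since \<open>N(s) = n\<close> means \<open>T n \<le> s < T (n + 1)\<close>, measurability of the event times makes the
  counts measurable.\<close>

lemma sets_history_subset:
  assumes "simple_point_process M T"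
  shows "sets (history M T t) \<subseteq> sets M"
proof -
  have "event_count T s -` {n} \<inter> space M \<in> sets M" if "0 \<le> s" for s n
  proof -
    have [measurable]: "\<And>k. T k \<in> borel_measurable M"
      using assms by (simp add: simple_point_process_def)
    have "event_count T s -` {n} \<inter> space M = {\<omega> \<in> space M. T n \<omega> \<le> s \<and> s < T (Suc n) \<omega>}"
      using event_count_eq_iff[OF assms _ that] by auto
    also have "\<dots> \<in> sets M" by measurable
    finally show ?thesis .
  qed
  then show ?thesis
    unfolding history_def by (subst sets_measure_of) (auto intro!: sets.sigma_sets_subset)
qed

lemma predictable_rectangle:
  assumes "\<And>s. space (F s) = space M" "0 \<le> s" "s < t" "A \<in> sets (F s)"
  shows "{s<..t} \<times> A \<in> sets (predictable M F)"
  unfolding predictable_def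
proof (subst sets_measure_of)
  show "{{s<..t} \<times> A | s t A. 0 \<le> s \<and> s < t \<and> A \<in> sets (F s)} \<subseteq> Pow ({0<..} \<times> space M)"
    using assms(1) sets.sets_into_space by fastforce
qed (use assms(2-) in blast)

text \<open>Evaluating a predictable process at an event time gives a random variable. This allows
  a vanishing expectation to be turned into an almost sure statement about the events.\<close>

lemma measurable_at_event:
  assumes "simple_point_process M T" "\<And>s. space (F s) = space M" "\<And>s. sets (F s) \<subseteq> sets M"
  shows "(\<lambda>\<omega>. (T (Suc k) \<omega>, \<omega>)) \<in> measurable M (predictable M F)"
  unfolding predictable_def
proof (rule measurable_measure_of)
  show "{{s<..t} \<times> A | s t A. 0 \<le> s \<and> s < t \<and> A \<in> sets (F s)} \<subseteq> Pow ({0<..} \<times> space M)"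
    using assms(2) sets.sets_into_space by fastforce
  show "(\<lambda>\<omega>. (T (Suc k) \<omega>, \<omega>)) \<in> space M \<rightarrow> {0<..} \<times> space M"
  proof
    fix \<omega> assume "\<omega> \<in> space M"
    then show "(T (Suc k) \<omega>, \<omega>) \<in> {0<..} \<times> space M"
      using assms(1) strict_mono_less[of "\<lambda>k. T k \<omega>" 0 "Suc k"]
      by (auto simp: simple_point_process_def)
  qed
  fix Y assume "Y \<in> {{s<..t} \<times> A | s t A. 0 \<le> s \<and> s < t \<and> A \<in> sets (F s)}"
  then obtain s t A where Y: "Y = {s<..t} \<times> A" and A: "A \<in> sets (F s)" by auto
  have [measurable]: "A \<in> sets M" "T (Suc k) \<in> borel_measurable M"
    using A assms by (auto simp: simple_point_process_def)
  have "(\<lambda>\<omega>. (T (Suc k) \<omega>, \<omega>)) -` Y \<inter> space M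
      = {\<omega> \<in> space M. s < T (Suc k) \<omega> \<and> T (Suc k) \<omega> \<le> t} \<inter> A"
    using sets.sets_into_space[of A M] by (auto simp: Y)
  also have "\<dots> \<in> sets M" by measurable
  finally show "(\<lambda>\<omega>. (T (Suc k) \<omega>, \<omega>)) -` Y \<inter> space M \<in> sets M" .
qed

text \<open>The largest multiple of \<open>1 / (n + 1)\<close> strictly below \<open>u\<close>. Strictness is what makes evaluation
  at this point a predictable operation.\<close>

definition left_grid :: "nat \<Rightarrow> real \<Rightarrow> real" where
  "left_grid n u = real_of_int (\<lceil>u * real (Suc n)\<rceil> - 1) / real (Suc n)"

lemma left_grid_bounds:
  fixes u :: real
  assumes "0 < u"
  shows "0 \<le> left_grid n u" "left_grid n u < u" "u - 1 / real (Suc n) \<le> left_grid n u"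
proof -
  have "0 < u * real (Suc n)" using assms by simp
  then have "1 \<le> \<lceil>u * real (Suc n)\<rceil>" by linarith
  then show "0 \<le> left_grid n u" unfolding left_grid_def by (simp add: field_simps)
  have "\<lceil>u * real (Suc n)\<rceil> - 1 < u * real (Suc n)" "u * real (Suc n) \<le> \<lceil>u * real (Suc n)\<rceil>" by linarith+
  then have "u * real (Suc n) - 1 \<le> real_of_int (\<lceil>u * real (Suc n)\<rceil> - 1)"
    "real_of_int (\<lceil>u * real (Suc n)\<rceil> - 1) < u * real (Suc n)" by linarith+
  then have "(u * real (Suc n) - 1) / real (Suc n) \<le> left_grid n u"
    "left_grid n u < (u * real (Suc n)) / real (Suc n)"
    unfolding left_grid_def
    by (simp_all only: divide_right_mono divide_strict_right_mono of_nat_0_le_iff of_nat_0_less_iff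
      zero_less_Suc)
  then show "left_grid n u < u" "u - 1 / real (Suc n) \<le> left_grid n u"
    by (simp_all add: diff_divide_distrib del: of_nat_Suc)
qed

lemma left_grid_eventually:
  assumes "0 < u" "a < u"
  shows "\<forall>\<^sub>F n in sequentially. a \<le> left_grid n u"
proof -
  obtain N where N: "inverse (real (Suc N)) < u - a" using reals_Archimedean assms(2)
    by (metis diff_gt_0_iff_gt)
  have "a \<le> left_grid n u" if "n \<ge> N" for n
  proof -
    have "1 / real (Suc n) \<le> inverse (real (Suc N))"
      using that by (simp add: field_simps)
    then show ?thesis using N left_grid_bounds(3)[OF assms(1), of n] by linarith
  qed
  then show ?thesis unfolding eventually_sequentially by blast
qed

text \<open>On each cell \<open>(j / (n + 1), (j + 1) / (n + 1)]\<close> the grid point is the left end, so the set is a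
  countable union of predictable rectangles.\<close>

lemma predictable_left_grid:
  assumes "\<And>s. space (F s) = space M" "\<And>t. 0 \<le> t \<Longrightarrow> {\<omega> \<in> space M. P t \<omega>} \<in> sets (F t)"
  shows "{(u, \<omega>). 0 < u \<and> \<omega> \<in> space M \<and> P (left_grid n u) \<omega>} \<in> sets (predictable M F)"
proof -
  define a where "a j = real j / real (Suc n)" for j
  have grid: "left_grid n u = a j \<longleftrightarrow> u \<in> {a j<..a (Suc j)}" for u j
  proof -
    have "left_grid n u = a j \<longleftrightarrow> \<lceil>u * real (Suc n)\<rceil> = int j + 1"
      unfolding left_grid_def a_def by (simp add: field_simps) linarith
    also have "\<dots> \<longleftrightarrow> u \<in> {a j<..a (Suc j)}"
      unfolding a_def by (simp add: ceiling_eq_iff field_simps)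
    finally show ?thesis .
  qed
  have ex: "\<exists>j. left_grid n u = a j" if "0 < u" for u
  proof -
    have "0 < u * real (Suc n)" using that by simp
    then have "1 \<le> \<lceil>u * real (Suc n)\<rceil>" by linarith
    then have "left_grid n u = a (nat (\<lceil>u * real (Suc n)\<rceil> - 1))" unfolding left_grid_def a_def by simp
    then show ?thesis ..
  qed
  have a0: "0 \<le> a j" "a j < a (Suc j)" for j by (auto simp: a_def divide_strict_right_mono)
  have "{(u, \<omega>). 0 < u \<and> \<omega> \<in> space M \<and> P (left_grid n u) \<omega>}
      = (\<Union>j. {a j<..a (Suc j)} \<times> {\<omega> \<in> space M. P (a j) \<omega>})" (is "?L = ?R")
  proof (intro set_eqI iffI)
    fix x assume "x \<in> ?L"
    then obtain u \<omega> where x: "x = (u, \<omega>)" "0 < u" "\<omega> \<in> space M" "P (left_grid n u) \<omega>" by auto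
    obtain j where j: "left_grid n u = a j" using ex x(2) by blast
    then have "u \<in> {a j<..a (Suc j)}" using grid by blast
    then show "x \<in> ?R" using x j by auto
  next
    fix x assume "x \<in> ?R"
    then obtain j u \<omega> where x: "x = (u, \<omega>)" "u \<in> {a j<..a (Suc j)}" "\<omega> \<in> space M" "P (a j) \<omega>"
      by blast
    moreover have "0 < u" using x(2) a0(1)[of j] by simp
    moreover have "left_grid n u = a j" using grid x(2) by blast
    ultimately show "x \<in> ?L" by simp
  qed
  also have "\<dots> \<in> sets (predictable M F)"
    using assms a0 by (intro sets.countable_UN) (auto intro!: predictable_rectangle)
  finally show ?thesis .
qed

text \<open>Adaptedness is the section at time \<open>t\<close> of joint measurability on \<open>[0, t]\<close>.\<close>

lemma conditional_intensity_adapted: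
  assumes "conditional_intensity M F T lam" "0 \<le> t"
  shows "lam t \<in> borel_measurable (F t)"
proof -
  have m: "(\<lambda>(s, \<omega>). lam s \<omega>) \<in> borel_measurable (restrict_space borel {0..t} \<Otimes>\<^sub>M F t)"
    using assms unfolding conditional_intensity_def by blast
  have "t \<in> space (restrict_space borel {0..t})" using assms(2) by (simp add: space_restrict_space)
  from measurable_compose[OF measurable_Pair1'[OF this] m] show ?thesis by simp
qed

section \<open>Positivity of the intensity between events\<close>

text \<open>This is the only place where monotonicity and the limit of the kernel enter. A nondecreasing
  kernel gives monotonicity of the underlying intensity between events; for a nonincreasing one the
  limit \<open>0\<close> is its infimum, so the kernel only adds to the baseline.\<close>

lemma underlying_intensity_pos_persists:
  assumes "lam0 > 0" "mono_on {0..} h \<or> antimono_on {0..} h" "(h \<longlongrightarrow> 0) at_top"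
    and sm: "strict_mono (\<lambda>k. T k \<omega>)"
    and su: "T n \<omega> \<le> s" "s \<le> u" "u < T (Suc n) \<omega>"
    and pos: "0 < underlying_intensity lam0 h T s \<omega>"
  shows "0 < underlying_intensity lam0 h T u \<omega>"
proof -
  have u: "underlying_intensity lam0 h T u \<omega> = lam0 + (\<Sum>k = 1..n. h (u - T k \<omega>))"
    using underlying_intensity_eq[where T = T, OF sm] su by simp
  have s: "underlying_intensity lam0 h T s \<omega> = lam0 + (\<Sum>k = 1..n. h (s - T k \<omega>))"
    using underlying_intensity_eq[where T = T, OF sm] su by simp
  have le: "T k \<omega> \<le> s" if "k \<le> n" for k
    using that strict_mono_less_eq[OF sm, of k n] su(1) by simp
  have leu: "T k \<omega> \<le> u" if "k \<le> n" for k using le[OF that] su(2) by simp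
  from assms(2) show ?thesis
  proof
    assume "mono_on {0..} h"
    then have "(\<Sum>k = 1..n. h (s - T k \<omega>)) \<le> (\<Sum>k = 1..n. h (u - T k \<omega>))"
      using le leu su(2) by (intro sum_mono) (auto elim!: mono_onD)
    then show ?thesis using pos u s by simp
  next
    assume anti: "antimono_on {0..} h"
    have "0 \<le> h x" if "0 \<le> x" for x
    proof (rule tendsto_upperbound[OF assms(3)])
      show "\<forall>\<^sub>F y in at_top. h y \<le> h x"
        using eventually_ge_at_top[of x]
        by eventually_elim (use anti that in \<open>auto simp: monotone_on_def\<close>)
    qed simp
    then have "0 \<le> (\<Sum>k = 1..n. h (u - T k \<omega>))" using leu by (intro sum_nonneg) simp
    then show ?thesis using assms(1) u by simp
  qed
qed

lemma restart_time_le: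
  assumes "T k \<omega> \<le> t" "0 < hawkes_intensity lam0 h T t \<omega>"
  shows "restart_time lam0 h T k \<omega> \<le> t"
  unfolding restart_time_def by (rule cInf_lower) (use assms in \<open>auto intro: bdd_belowI[of _ "T k \<omega>"]\<close>)

text \<open>The witness \<open>s\<close> guarantees that the infimum is taken over a nonempty set.\<close>

lemma restart_time_greatest:
  assumes "T k \<omega> \<le> s" "0 < hawkes_intensity lam0 h T s \<omega>"
    and "\<And>t. T k \<omega> \<le> t \<Longrightarrow> 0 < hawkes_intensity lam0 h T t \<omega> \<Longrightarrow> r \<le> t"
  shows "r \<le> restart_time lam0 h T k \<omega>"
  unfolding restart_time_def by (rule cInf_greatest) (use assms in auto)

text \<open>The predictable set \<open>D\<close> collects the times preceded by zero intensity ever since the last event.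
  The intensity integrates to \<open>0\<close> over \<open>D\<close>, so almost surely no event falls in \<open>D\<close>.\<close>

lemma AE_intensity_pos_before_event:
  assumes hp: "hawkes_process M lam0 h T"
    and persist: "\<And>\<omega> n s u. \<omega> \<in> space M \<Longrightarrow> T n \<omega> \<le> s \<Longrightarrow> s \<le> u \<Longrightarrow> u < T (Suc n) \<omega> \<Longrightarrow>
      0 < hawkes_intensity lam0 h T s \<omega> \<Longrightarrow> 0 < hawkes_intensity lam0 h T u \<omega>"
  shows "AE \<omega> in M. \<forall>k. \<exists>s. T k \<omega> \<le> s \<and> s < T (Suc k) \<omega> \<and> 0 < hawkes_intensity lam0 h T s \<omega>"
proof -
  define lam where "lam = hawkes_intensity lam0 h T"
  define F where "F = history M T"
  have spp: "simple_point_process M T" and ci: "conditional_intensity M F T lam"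
    using hp by (auto simp: hawkes_process_def lam_def F_def)
  have spF: "space (F s) = space M" and sF: "sets (F s) \<subseteq> sets M" for s
    by (auto simp: F_def space_history sets_history_subset[OF spp, THEN subsetD])
  have nonneg: "0 \<le> lam s \<omega>" for s \<omega> by (simp add: lam_def hawkes_intensity_def)
  define Z where "Z n = {(u, \<omega>). 0 < u \<and> \<omega> \<in> space M \<and> lam (left_grid n u) \<omega> = 0}" for n
  \<comment> \<open>Vanishing at all sufficiently fine left grid points expresses, by countable operations, that
    the intensity vanishes since the last event; \<open>D_iff\<close> below makes this precise.\<close>
  define D where "D = (\<Union>N. \<Inter>n\<in>{N..}. Z n)"
  have Z: "Z n \<in> sets (predictable M F)" for n unfolding Z_def
  proof (rule predictable_left_grid)
    show "space (F s) = space M" for s by (rule spF)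
    fix t :: real assume "0 \<le> t"
    then have "lam t \<in> borel_measurable (F t)" by (rule conditional_intensity_adapted[OF ci])
    then have "{\<omega> \<in> space (F t). lam t \<omega> = 0} \<in> sets (F t)" by measurable
    then show "{\<omega> \<in> space M. lam t \<omega> = 0} \<in> sets (F t)" by (simp add: spF)
  qed
  have D: "D \<in> sets (predictable M F)"
    unfolding D_def using Z by (intro sets.countable_UN sets.countable_INT'') auto
  have D_iff: "(u, \<omega>) \<in> D \<longleftrightarrow> (\<forall>s. T k \<omega> \<le> s \<and> s < u \<longrightarrow> lam s \<omega> = 0)"
    if w: "\<omega> \<in> space M" and u: "T k \<omega> < u" "u \<le> T (Suc k) \<omega>" for u \<omega> k
  proof -
    have "0 \<le> T k \<omega>"
      using spp w strict_mono_less_eq[of "\<lambda>k. T k \<omega>" 0 k]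
      by (auto simp: simple_point_process_def)
    then have u0: "0 < u" using u by simp
    have "(u, \<omega>) \<in> D \<longleftrightarrow> (\<forall>\<^sub>F n in sequentially. lam (left_grid n u) \<omega> = 0)"
      using u0 w by (auto simp: D_def Z_def eventually_sequentially)
    also have "\<dots> \<longleftrightarrow> (\<forall>s. T k \<omega> \<le> s \<and> s < u \<longrightarrow> lam s \<omega> = 0)"
    proof (intro iffI allI impI)
      fix s assume ev: "\<forall>\<^sub>F n in sequentially. lam (left_grid n u) \<omega> = 0" and s: "T k \<omega> \<le> s \<and> s < u"
      then have "\<forall>\<^sub>F n in sequentially. lam (left_grid n u) \<omega> = 0 \<and> s \<le> left_grid n u"
        using left_grid_eventually[OF u0] by (auto intro: eventually_conj)
      then obtain n where n: "lam (left_grid n u) \<omega> = 0" "s \<le> left_grid n u"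
        using eventually_happens'[OF sequentially_bot] by blast
      show "lam s \<omega> = 0"
      proof (rule ccontr)
        assume "lam s \<omega> \<noteq> 0"
        then have "0 < lam s \<omega>" using nonneg[of s \<omega>] by simp
        then have "0 < lam (left_grid n u) \<omega>"
          using persist[OF w, of k s "left_grid n u"] s u n left_grid_bounds(2)[OF u0, of n]
          by (simp add: lam_def)
        then show False using n by simp
      qed
    next
      assume z: "\<forall>s. T k \<omega> \<le> s \<and> s < u \<longrightarrow> lam s \<omega> = 0"
      show "\<forall>\<^sub>F n in sequentially. lam (left_grid n u) \<omega> = 0"
        using left_grid_eventually[OF u0 u(1)]
        by eventually_elim (use z left_grid_bounds(2)[OF u0] in blast)
    qed
    finally show ?thesis .
  qed
  have inner: "(\<integral>\<^sup>+u\<in>{0<..}. indicator D (u, \<omega>) * ennreal (lam u \<omega>) \<partial>lborel) = 0"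
    if w: "\<omega> \<in> space M" for \<omega>
  proof -
    \<comment> \<open>At a time \<open>u\<close> of \<open>D\<close> strictly between two events, positivity of the intensity makes \<open>u\<close> the
      first time of positivity since the last event, i.e. its restart time.\<close>
    define E where "E = range (\<lambda>k. T k \<omega>) \<union> range (\<lambda>k. restart_time lam0 h T k \<omega>)"
    have "countable E" by (simp add: E_def)
    have zero: "indicator D (u, \<omega>) * ennreal (lam u \<omega>) * indicator {0<..} u = 0"
      if uE: "u \<notin> E" for u
    proof (rule ccontr)
      assume "\<not> ?thesis"
      then have u: "0 < u" "(u, \<omega>) \<in> D" "0 < lam u \<omega>"
        by (auto simp: indicator_def ennreal_eq_0_iff not_le split: if_splits)
      obtain k where k: "T k \<omega> \<le> u" "u < T (Suc k) \<omega>"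
        using ex_event_interval[OF spp w] u(1) by (metis less_imp_le)
      have "T k \<omega> \<noteq> u" using uE by (auto simp: E_def)
      then have ku: "T k \<omega> < u" using k by simp
      have "\<forall>s. T k \<omega> \<le> s \<and> s < u \<longrightarrow> lam s \<omega> = 0"
        using D_iff[OF w ku] k u(2) by simp
      then have "u \<le> restart_time lam0 h T k \<omega>"
        using u(3) k by (intro restart_time_greatest[of T k \<omega> u]) (auto simp: lam_def not_less[symmetric])
      moreover have "restart_time lam0 h T k \<omega> \<le> u"
        using restart_time_le[of T k \<omega> u] u(3) k by (simp add: lam_def)
      ultimately have "u = restart_time lam0 h T k \<omega>" by simp
      then show False using uE by (auto simp: E_def)
    qed
    have "AE u in lborel. u \<notin> E"
      by (rule AE_not_in) (rule countable_imp_null_set_lborel[OF \<open>countable E\<close>])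
    then have "AE u in lborel. indicator D (u, \<omega>) * ennreal (lam u \<omega>) * indicator {0<..} u = 0"
      by eventually_elim (rule zero)
    then have "(\<integral>\<^sup>+u\<in>{0<..}. indicator D (u, \<omega>) * ennreal (lam u \<omega>) \<partial>lborel)
        = (\<integral>\<^sup>+u. 0 \<partial>(lborel :: real measure))" by (rule nn_integral_cong_AE)
    then show ?thesis by simp
  qed
  have "(\<integral>\<^sup>+\<omega>. (\<Sum>k. indicator D (T (Suc k) \<omega>, \<omega>)) \<partial>M)
      = (\<integral>\<^sup>+\<omega>. (\<integral>\<^sup>+u\<in>{0<..}. indicator D (u, \<omega>) * ennreal (lam u \<omega>) \<partial>lborel) \<partial>M)"
    using ci D unfolding conditional_intensity_def by (auto dest: spec[of _ "indicator D"])
  also have "\<dots> = (\<integral>\<^sup>+\<omega>. 0 \<partial>M)" by (rule nn_integral_cong) (rule inner)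
  finally have int0: "(\<integral>\<^sup>+\<omega>. (\<Sum>k. indicator D (T (Suc k) \<omega>, \<omega>)) \<partial>M) = 0" by simp
  have "(\<lambda>\<omega>. indicator D (T (Suc k) \<omega>, \<omega>) :: ennreal) \<in> borel_measurable M" for k
    by (rule measurable_compose[OF measurable_at_event[OF spp spF sF] borel_measurable_indicator[OF D]])
  then have "(\<lambda>\<omega>. (\<Sum>k. indicator D (T (Suc k) \<omega>, \<omega>)) :: ennreal) \<in> borel_measurable M"
    by measurable
  from int0 nn_integral_0_iff_AE[OF this]
  have "AE \<omega> in M. (\<Sum>k. indicator D (T (Suc k) \<omega>, \<omega>)) = (0::ennreal)" by simp
  with AE_space show ?thesis
  proof eventually_elim
    case (elim \<omega>)
    show ?case
    proof
      fix k
      have "indicator D (T (Suc k) \<omega>, \<omega>) = (0::ennreal)"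
        using elim(2) by (subst (asm) suminf_eq_zero_iff) auto
      then have "(T (Suc k) \<omega>, \<omega>) \<notin> D" by (simp add: indicator_def split: if_splits)
      moreover have "T k \<omega> < T (Suc k) \<omega>"
        using spp elim(1) by (auto simp: simple_point_process_def strict_mono_def)
      ultimately obtain s where "T k \<omega> \<le> s" "s < T (Suc k) \<omega>" "lam s \<omega> \<noteq> 0"
        using D_iff[OF elim(1), of k "T (Suc k) \<omega>"] by auto
      with nonneg[of s \<omega>]
      show "\<exists>s. T k \<omega> \<le> s \<and> s < T (Suc k) \<omega> \<and> 0 < hawkes_intensity lam0 h T s \<omega>"
        by (auto simp: lam_def intro!: exI[of _ s])
    qed
  qed
qed

section \<open>Integrating the intensity over one inter-event interval\<close>

text \<open>The functions are compared on open intervals only, because at an event time the intensity jumps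
  and receives the summand \<open>h 0\<close>, and at a restart time its positivity is undecided.\<close>

lemma interval_integral_zero_then_eq:
  fixes f g :: "real \<Rightarrow> real" and a r b :: real
  assumes "a \<le> r" "r \<le> b" "set_integrable lborel {a..b} f"
    and "\<And>u. a < u \<Longrightarrow> u < r \<Longrightarrow> f u = 0" "\<And>u. r < u \<Longrightarrow> u < b \<Longrightarrow> f u = g u"
  shows "(LBINT u=a..b. f u) = (LBINT u=r..b. g u)"
proof -
  have "set_integrable lborel {a<..<b} f"
    by (rule set_integrable_subset[OF assms(3)]) auto
  then have "interval_lebesgue_integrable lborel (ereal a) (ereal b) f"
    using assms(1,2) by (simp add: interval_lebesgue_integrable_def)
  then have "(LBINT u=a..r. f u) + (LBINT u=r..b. f u) = (LBINT u=a..b. f u)"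
    using assms(1,2) by (intro interval_integral_sum) (simp add: min_def max_def)
  moreover have "(LBINT u=a..r. f u) = (LBINT u=a..r. 0)"
    using assms(1,4) by (intro interval_integral_cong) (simp add: einterval_eq)
  moreover have "(LBINT u=r..b. f u) = (LBINT u=r..b. g u)"
    using assms(2,5) by (intro interval_integral_cong) (simp add: einterval_eq)
  ultimately show ?thesis by simp
qed

text \<open>The restart time splits the interval into a part without intensity and, by persistence of
  positivity, a part where the positive part can be dropped. The case \<open>b = T (Suc k)\<close> treats a
  completed inter-event interval, the case of smaller \<open>b\<close> the current one.\<close>

lemma hawkes_integral_between_events:
  assumes ab: "T k \<omega> \<le> b" "b \<le> T (Suc k) \<omega>"
    and int: "set_integrable lborel {T k \<omega>..b} (\<lambda>u. hawkes_intensity lam0 h T u \<omega>)"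
    and pos: "\<exists>s. T k \<omega> \<le> s \<and> s < T (Suc k) \<omega> \<and> 0 < hawkes_intensity lam0 h T s \<omega>"
    and persist: "\<And>s u. T k \<omega> \<le> s \<Longrightarrow> s \<le> u \<Longrightarrow> u < T (Suc k) \<omega> \<Longrightarrow>
      0 < hawkes_intensity lam0 h T s \<omega> \<Longrightarrow> 0 < hawkes_intensity lam0 h T u \<omega>"
  shows "(LBINT u=T k \<omega>..b. hawkes_intensity lam0 h T u \<omega>) =
    (if b < restart_time lam0 h T k \<omega> then 0
     else (LBINT u=restart_time lam0 h T k \<omega>..b. underlying_intensity lam0 h T u \<omega>))"
proof -
  define r where "r = restart_time lam0 h T k \<omega>"
  have zero: "hawkes_intensity lam0 h T u \<omega> = 0" if "T k \<omega> < u" "u < r" for u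
    using restart_time_le[of T k \<omega> u lam0 h] that
    by (fastforce simp: r_def hawkes_intensity_def)
  have eq: "hawkes_intensity lam0 h T u \<omega> = underlying_intensity lam0 h T u \<omega>"
    if "r < u" "u < b" for u
  proof -
    have "\<not> u \<le> restart_time lam0 h T k \<omega>" using that(1) by (simp add: r_def)
    then obtain s where "T k \<omega> \<le> s" "s < u" "0 < hawkes_intensity lam0 h T s \<omega>"
      using restart_time_greatest[of T k \<omega> _ lam0 h u] pos by (metis not_le)
    then have "0 < hawkes_intensity lam0 h T u \<omega>" using persist[of s u] that ab by simp
    then show ?thesis by (simp add: hawkes_intensity_def)
  qed
  have "T k \<omega> \<le> r" unfolding r_def using pos by (auto intro: restart_time_greatest)
  show ?thesis
  proof (cases "b < r")
    case True
    \<comment> \<open>The intensity vanishes on the whole interval, so its end \<open>b\<close> serves as splitting point.\<close>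
    then have "(LBINT u=T k \<omega>..b. hawkes_intensity lam0 h T u \<omega>) = (LBINT u=b..b. 0)"
      using ab int zero by (intro interval_integral_zero_then_eq) auto
    then show ?thesis using True by (simp add: r_def)
  next
    case False
    then have "(LBINT u=T k \<omega>..b. hawkes_intensity lam0 h T u \<omega>)
        = (LBINT u=r..b. underlying_intensity lam0 h T u \<omega>)"
      using ab int zero eq \<open>T k \<omega> \<le> r\<close> by (intro interval_integral_zero_then_eq) auto
    then show ?thesis using False by (simp add: r_def)
  qed
qed

section \<open>The compensator\<close>

theorem proposition3p1:
  fixes M :: "'a measure" and T :: "nat \<Rightarrow> 'a \<Rightarrow> real"
    and lam0 :: real and h :: "real \<Rightarrow> real"
  assumes "lam0 > 0"
    and "h \<in> borel_measurable (restrict_space borel {0..})"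
    and "mono_on {0..} h \<or> antimono_on {0..} h"
    and "(h \<longlongrightarrow> 0) at_top"
    and "hawkes_process M lam0 h T"
  shows "AE \<omega> in M. \<forall>t>0.
    compensator lam0 h T t \<omega> =
      (if t < T 1 \<omega> then lam0 * t
       else lam0 * T 1 \<omega>
         + (\<Sum>k = 1..event_count T t \<omega> - 1.
              (LBINT u=restart_time lam0 h T k \<omega>..T (k + 1) \<omega>. underlying_intensity lam0 h T u \<omega>))
         + (if t < restart_time lam0 h T (event_count T t \<omega>) \<omega> then 0
            else (LBINT u=restart_time lam0 h T (event_count T t \<omega>) \<omega>..t.
                    underlying_intensity lam0 h T u \<omega>)))"
proof -
  have spp: "simple_point_process M T"
    and ci: "conditional_intensity M (history M T) T (hawkes_intensity lam0 h T)"
    using assms(5) by (auto simp: hawkes_process_def)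
  have persist: "0 < hawkes_intensity lam0 h T u \<omega>"
    if "\<omega> \<in> space M" "T n \<omega> \<le> s" "s \<le> u" "u < T (Suc n) \<omega>" "0 < hawkes_intensity lam0 h T s \<omega>"
    for \<omega> n s u
  proof -
    have "strict_mono (\<lambda>k. T k \<omega>)" using spp that(1) by (simp add: simple_point_process_def)
    then show ?thesis
      using underlying_intensity_pos_persists[OF assms(1,3,4), of T \<omega> n s u] that
      by (simp add: hawkes_intensity_def)
  qed
  have int: "AE \<omega> in M. \<forall>t\<ge>0. set_integrable lborel {0..t} (\<lambda>u. hawkes_intensity lam0 h T u \<omega>)"
    using ci unfolding conditional_intensity_def by blast
  have "AE \<omega> in M. \<forall>k. \<exists>s. T k \<omega> \<le> s \<and> s < T (Suc k) \<omega> \<and> 0 < hawkes_intensity lam0 h T s \<omega>"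
    by (rule AE_intensity_pos_before_event[OF assms(5)]) (rule persist)
  then show ?thesis
    using int AE_space
  proof eventually_elim
    case (elim \<omega>)
    define lam where "lam = (\<lambda>u. hawkes_intensity lam0 h T u \<omega>)"
    define r where "r k = restart_time lam0 h T k \<omega>" for k
    define J where "J k b = (LBINT u=r k..b. underlying_intensity lam0 h T u \<omega>)" for k and b :: real
    have T0: "T 0 \<omega> = 0" and sm: "strict_mono (\<lambda>k. T k \<omega>)"
      using spp elim(3) by (auto simp: simple_point_process_def)
    have Tnn: "0 \<le> T k \<omega>" for k using strict_mono_less_eq[OF sm, of 0 k] T0 by simp
    have Tlt: "T k \<omega> < T (Suc k) \<omega>" for k using strict_mono_less[OF sm, of k "Suc k"] by simp
    have intg: "set_integrable lborel {a..b} lam" if "0 \<le> a" for a b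
    proof -
      have "set_integrable lborel {0..max 0 b} lam"
        using elim(2) by (simp add: lam_def)
      then show ?thesis by (rule set_integrable_subset) (use that in auto)
    qed
    have step: "(LBINT u=0..b. lam u) = (LBINT u=0..T k \<omega>. lam u) + (if b < r k then 0 else J k b)"
      if "T k \<omega> \<le> b" "b \<le> T (Suc k) \<omega>" for k b
    proof -
      have "set_integrable lborel {0<..<b} lam"
        by (rule set_integrable_subset[OF intg[of 0 b]]) auto
      then have "interval_lebesgue_integrable lborel (ereal 0) (ereal b) lam"
        using Tnn[of k] that by (simp add: interval_lebesgue_integrable_def)
      then have "(LBINT u=ereal 0..T k \<omega>. lam u) + (LBINT u=T k \<omega>..b. lam u) = (LBINT u=ereal 0..b. lam u)"
        using Tnn[of k] that by (intro interval_integral_sum) (simp add: min_def max_def)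
      moreover have "(LBINT u=T k \<omega>..b. lam u) = (if b < r k then 0 else J k b)"
        unfolding lam_def r_def J_def
        using that elim(1) persist[OF elim(3)] intg[OF Tnn]
        by (intro hawkes_integral_between_events) (auto simp: lam_def)
      ultimately show ?thesis by (simp add: zero_ereal_def)
    qed
    \<comment> \<open>Hence the case distinction in \<open>step\<close> disappears for completed inter-event intervals.\<close>
    have rlt: "r k < T (Suc k) \<omega>" for k
      using elim(1) restart_time_le[of T k \<omega> _ lam0 h] unfolding r_def by (meson le_less_trans)
    have first: "(LBINT u=0..b. lam u) = lam0 * b" if "0 \<le> b" "b \<le> T 1 \<omega>" for b
    proof -
      have "(LBINT u=ereal 0..b. lam u) = (LBINT u=ereal 0..b. lam0)"
      proof (rule interval_integral_cong)
        fix u assume "u \<in> einterval (min (ereal 0) b) (max (ereal 0) b)"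
        then have u: "T 0 \<omega> \<le> u" "u < T (Suc 0) \<omega>" using that T0 by (auto simp: einterval_eq)
        show "lam u = lam0"
          using underlying_intensity_eq[where T = T, OF sm u, of lam0 h] assms(1)
          by (simp add: lam_def hawkes_intensity_def)
      qed
      also have "\<dots> = lam0 * b" using that by simp
      finally show ?thesis by (simp add: zero_ereal_def)
    qed
    have upto: "(LBINT u=0..T (Suc n) \<omega>. lam u) = lam0 * T 1 \<omega> + (\<Sum>k = 1..n. J k (T (k + 1) \<omega>))" for n
    proof (induction n)
      case 0
      show ?case using first[of "T 1 \<omega>"] Tnn[of 1] by simp
    next
      case (Suc n)
      have "(LBINT u=0..T (Suc (Suc n)) \<omega>. lam u)
          = (LBINT u=0..T (Suc n) \<omega>. lam u) + J (Suc n) (T (Suc (Suc n)) \<omega>)"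
        using step[of "Suc n" "T (Suc (Suc n)) \<omega>"] Tlt[of "Suc n"] rlt[of "Suc n"] by simp
      then show ?case using Suc by simp
    qed
    have "(LBINT u=0..t. lam u) =
      (if t < T 1 \<omega> then lam0 * t
       else lam0 * T 1 \<omega> + (\<Sum>k = 1..event_count T t \<omega> - 1. J k (T (k + 1) \<omega>))
         + (if t < r (event_count T t \<omega>) then 0 else J (event_count T t \<omega>) t))"
      if "0 < t" for t
    proof (cases "t < T 1 \<omega>")
      case True
      then show ?thesis using first[of t] that by simp
    next
      case False
      obtain n where n: "T n \<omega> \<le> t" "t < T (Suc n) \<omega>"
        by (rule ex_event_interval[OF spp elim(3) less_imp_le[OF \<open>0 < t\<close>]])
      have N: "event_count T t \<omega> = n" by (rule event_count_eq[where T = T, OF sm n])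
      obtain m where m: "n = Suc m" using False n by (cases n) auto
      show ?thesis using False step[of n t] n upto[of m] N m by simp
    qed
    then show ?case unfolding compensator_def lam_def r_def J_def by simp
  qed
qed

end
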